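(* The circles of partition $\mathcal{C}(n)$, $n\in\mathbb{N}$, admit aligned embedding. That is, for all $n,m\in\mathbb{N}$ generating two distinct circles of partition $\mathcal{C}(n)$ and $\mathcal{C}(m)$, one has $\mathcal{C}(n)\subset\mathcal{C}(m)$ (proper inclusion) if and only if $n<m$, and $\mathcal{C}(n)\supset\mathcal{C}(m)$ (proper inclusion) if and only if $n>m$; moreover, for all $n,m\in\mathbb{N}$, $\mathcal{C}(n)=\mathcal{C}(m)$ if and only if $n=m$.
   Context: $\mathbb{N}$ is the set of positive integers. The circle of partition (CoP) generated by $n\in\mathbb{N}$ with base set $\mathbb{N}$ is $\mathcal{C}(n)=\{[x] : x,y\in\mathbb{N},\ x+y=n\}$. Points $[x]$ are formal symbols identified by their weight $x$, so $\mathcal{C}(n)$ may be identified with $\{x\in\mathbb{N}: n-x\in\mathbb{N}\}$. For a base set $\mathbb{M}\subseteq\mathbb{N}$ and $\mathcal{C}(n,\mathbb{M})=\{[x]: x,y\in\mathbb{M},\ x+y=n\}$, distinct CoPs $\mathcal{C}(n,\mathbb{M})$, $\mathcal{C}(m,\mathbb{M})$ admit aligned embedding if and only if $\mathcal{C}(n,\mathbb{M})\subset\mathcal{C}(m,\mathbb{M})$ holds with $n<m$, $\mathcal{C}(n,\mathbb{M})\supset\mathcal{C}(m,\mathbb{M})$ holds with $n>m$, and $\mathcal{C}(n,\mathbb{M})=\mathcal{C}(m,\mathbb{M})$ holds if and only if $n=m$. *)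

theory Defs
  imports Main
begin

definition Npos :: "nat set" where
  "Npos = {n. 0 < n}"

(* Point x is the formal symbol [x]; the datatype constructor is injective,
   so a point is determined by its weight x. *)
datatype point = Point (weight: nat)

definition cop :: "nat \<Rightarrow> nat set \<Rightarrow> point set" where
  "cop n M = {Point x | x y. x \<in> M \<and> y \<in> M \<and> x + y = n}"

(* A property of the pair of generators n, m; the requirement that the two
   circles be distinct is made where the predicate is used. *)
definition admit_aligned_embedding :: "nat set \<Rightarrow> nat \<Rightarrow> nat \<Rightarrow> bool" where
  "admit_aligned_embedding M n m \<longleftrightarrow>
     (cop n M \<subset> cop m M \<longleftrightarrow> n < m) \<and>
     (cop n M \<supset> cop m M \<longleftrightarrow> n > m) \<and>
     (cop n M = cop m M \<longleftrightarrow> n = m)"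

end

theory Submission
  imports Defs
begin

text \<open>
  Over the positive integers a point \<open>[x]\<close> lies on the circle generated by \<open>n\<close> as soon as
  its partner \<open>n - x\<close> is positive, so the circle is the initial segment of weights
  \<open>1, \<dots>, n - 1\<close>. Hence the circles form a chain, and for positive \<open>n\<close> the
  segment determines \<open>n\<close>: a larger generator \<open>m > n\<close> contributes the point \<open>[n]\<close>,
  which is not on the circle of \<open>n\<close>. All three equivalences follow from this strict
  monotonicity by trichotomy.
\<close>

lemma Point_mem_cop_Npos: "Point x \<in> cop n Npos \<longleftrightarrow> 0 < x \<and> x < n"
proof
  assume "0 < x \<and> x < n"
  then have "x \<in> Npos" "n - x \<in> Npos" "x + (n - x) = n"
    by (auto simp: Npos_def)
  then show "Point x \<in> cop n Npos"
    unfolding cop_def by blast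
qed (auto simp: cop_def Npos_def)

text \<open>
  Positivity of the smaller generator matters: the circles generated by 0 and by 1 are both
  empty.
\<close>

lemma cop_Npos_strict_mono:
  assumes "0 < n" and "n < m"
  shows "cop n Npos \<subset> cop m Npos"
proof
  show "cop n Npos \<subseteq> cop m Npos"
  proof
    fix p assume "p \<in> cop n Npos"
    with \<open>n < m\<close> show "p \<in> cop m Npos"
      by (cases p) (simp add: Point_mem_cop_Npos)
  qed
  \<comment> \<open>The point \<open>[n]\<close> separates the two circles.\<close>
  have "Point n \<in> cop m Npos" "Point n \<notin> cop n Npos"
    using assms by (simp_all add: Point_mem_cop_Npos)
  then show "cop n Npos \<noteq> cop m Npos"
    by blast
qed

lemma admit_aligned_embedding_Npos:
  assumes "0 < n" and "0 < m"
  shows "admit_aligned_embedding Npos n m"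
  using cop_Npos_strict_mono[OF \<open>0 < n\<close>, of m] cop_Npos_strict_mono[OF \<open>0 < m\<close>, of n]
  unfolding admit_aligned_embedding_def
  by (cases n m rule: linorder_cases) auto

theorem theorem2p9:
  "(\<forall>n\<in>Npos. \<forall>m\<in>Npos. cop n Npos \<noteq> cop m Npos \<longrightarrow> admit_aligned_embedding Npos n m) \<and>
   (\<forall>n\<in>Npos. \<forall>m\<in>Npos. cop n Npos = cop m Npos \<longleftrightarrow> n = m)"
proof -
  have "admit_aligned_embedding Npos n m" if "n \<in> Npos" "m \<in> Npos" for n m
    using that admit_aligned_embedding_Npos by (simp add: Npos_def)
  then show ?thesis
    unfolding admit_aligned_embedding_def by blast
qed

end
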